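(* There exists an instance (with a credible agent) where an optimal PIE mechanism yields a strictly higher expected payoff for the principal than any non-PIE (indefinite-stage) mechanism does.
   Context: An instance consists of finite sets $\Theta$ (states), $A$ (actions), $T$ (agent types), a prior $\mu\in\Delta(\Theta)$, a type distribution $\rho\in\Delta(T)$ (zero-probability types are allowed), a principal payoff function $v(\theta,a)$ and agent payoff functions $u_t(\theta,a)$, $t\in T$. The state $\theta\sim\mu$ is observed only by the principal; the agent's type $t\sim\rho$, independent of $\theta$, is known only to the agent. The principal commits to a mechanism; when action $a$ is finally played the principal gets $v(\theta,a)$ and an agent of true type $t$ gets $u_t(\theta,a)$. A non-PIE (indefinite-stage) mechanism is a finite rooted tree with nodes of the following kinds: - $\mathsf S$ node (signaling): it carries a strategy $\pi:\Theta\to\Delta(G)$, $G$ finite, and has one child per signal; a signal $g\sim\pi(\cdot\mid\theta)$ is sent and play moves to the child of $g$. - $\mathsf E$ node (direct binding elicitation): it has one child per type in $T$; the agent reports a type and play moves to the corresponding child. - $\widetilde{\mathsf E}$ node (non-binding elicitation): the agent selects one of its children; this imposes no restriction on later behavior. - Leaf: the mechanism terminates and the agent plays an action. A PIE (partial information elicitation) mechanism is defined in the same way except that an $\mathsf E$ node may elicit partial type information: for a node $x$ let $T_x\subseteq T$ be the set of types not yet excluded by the agent's answers on the path to $x$ ($T_x=T$ at the root); at an $\mathsf E$ node $x$ the principal presents several subsets of $T_x$ that together cover $T_x$, one per child, and the agent selects one of them as containing his type; $T_c$ of the resulting child $c$ is the selected subset. The agent knows the mechanism and observes the path; his posterior at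 a node is the Bayesian posterior on $\theta$ given the signals received. The agent is credible (elicitation at $\mathsf E$ nodes is binding): at a leaf $x$ he must play an action that maximizes, under his posterior, the expected payoff of some type consistent with his binding answers (the reported type in the direct case, some type in $T_x$ in the PIE case, any type if no binding elicitation took place), even if this is not his true type. Subject to this, an agent of true type $t$ makes all choices to maximize his expected payoff under $u_t$. Ties are broken as the mechanism decides. *)

theory Defs
  imports "HOL-Probability.Probability_Mass_Function"
begin

record ('s, 'a, 't) persuasion_instance =
  States :: "'s set"
  Actions :: "'a set"
  Types :: "'t set"
  prior :: "'s pmf"
  type_dist :: "'t pmf"
  principal_payoff :: "'s \<Rightarrow> 'a \<Rightarrow> real"
  agent_payoff :: "'t \<Rightarrow> 's \<Rightarrow> 'a \<Rightarrow> real"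

text \<open>The set of types may be larger than the support of the type distribution; types of
  probability zero still matter, since the agent may bind himself to them.\<close>

definition valid_instance :: "('s, 'a, 't) persuasion_instance \<Rightarrow> bool" where
  "valid_instance I \<longleftrightarrow>
     finite (States I) \<and> finite (Actions I) \<and> Actions I \<noteq> {} \<and> finite (Types I) \<and>
     set_pmf (prior I) \<subseteq> States I \<and> set_pmf (type_dist I) \<subseteq> Types I"

text \<open>
  Mechanism trees. The children of a node are given by a function, of which only the values on the
  finite index set of the node are meaningful: the signals \<open>G\<close>, the options \<open>C\<close>, the presented
  subsets \<open>P\<close>, or the set of types at a \<open>Direct\<close> node.

  The nodes \<open>Signal\<close>, \<open>Direct\<close> (one child per type) and \<open>Ask\<close> (non-binding) are available to all
  mechanisms; \<open>Partial\<close> nodes, with one child per presented set of types, elicit partial information.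

  The component of type \<open>'t \<Rightarrow> _\<close> that precedes the children (the only component of a \<open>Leaf\<close>) is the
  choice made at the node by an agent of that true type. The predicate \<open>rational\<close> below
  forces it to be an optimal choice of the agent, so what is left to the mechanism is the breaking
  of ties.
\<close>

datatype ('s, 'a, 't) mech =
    Leaf "'t \<Rightarrow> 'a"
  | Signal "nat set" "'s \<Rightarrow> nat pmf" "nat \<Rightarrow> ('s, 'a, 't) mech"
  | Direct "'t \<Rightarrow> 't" "'t \<Rightarrow> ('s, 'a, 't) mech"
  | Partial "'t set set" "'t \<Rightarrow> 't set" "'t set \<Rightarrow> ('s, 'a, 't) mech"
  | Ask "nat set" "'t \<Rightarrow> nat" "nat \<Rightarrow> ('s, 'a, 't) mech"

text \<open>
  In what follows \<open>R\<close> is the set of types consistent with the binding answers given so far. A binding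
  answer must be consistent with the earlier ones; in particular, at a \<open>Direct\<close> node below another
  one, only the type reported before can be reported again.
\<close>

primrec well_formed :: "('s, 'a, 't) persuasion_instance \<Rightarrow> ('s, 'a, 't) mech \<Rightarrow> 't set \<Rightarrow> bool" where
  "well_formed I (Leaf ch) R \<longleftrightarrow> True"
| "well_formed I (Signal G p f) R \<longleftrightarrow>
     finite G \<and> (\<forall>s\<in>States I. set_pmf (p s) \<subseteq> G) \<and> (\<forall>g\<in>G. well_formed I (f g) R)"
| "well_formed I (Direct ch f) R \<longleftrightarrow> (\<forall>t\<in>R. well_formed I (f t) {t})"
| "well_formed I (Partial P ch f) R \<longleftrightarrow>
     {} \<notin> P \<and> \<Union> P = R \<and> (\<forall>Q\<in>P. well_formed I (f Q) Q)"
| "well_formed I (Ask C ch f) R \<longleftrightarrow>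
     finite C \<and> C \<noteq> {} \<and> (\<forall>c\<in>C. well_formed I (f c) R)"

primrec direct_only :: "('s, 'a, 't) persuasion_instance \<Rightarrow> ('s, 'a, 't) mech \<Rightarrow> 't set \<Rightarrow> bool" where
  "direct_only I (Leaf ch) R \<longleftrightarrow> True"
| "direct_only I (Signal G p f) R \<longleftrightarrow> (\<forall>g\<in>G. direct_only I (f g) R)"
| "direct_only I (Direct ch f) R \<longleftrightarrow> (\<forall>t\<in>R. direct_only I (f t) {t})"
| "direct_only I (Partial P ch f) R \<longleftrightarrow> False"
| "direct_only I (Ask C ch f) R \<longleftrightarrow> (\<forall>c\<in>C. direct_only I (f c) R)"

text \<open>Expected value of the payoff function \<open>w\<close> when the state is \<open>s\<close> and the true type is \<open>t\<close>.\<close>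

primrec play :: "('s \<Rightarrow> 'a \<Rightarrow> real) \<Rightarrow> 's \<Rightarrow> 't \<Rightarrow> ('s, 'a, 't) mech \<Rightarrow> real" where
  "play w s t (Leaf ch) = w s (ch t)"
| "play w s t (Signal G p f) = (\<Sum>g\<in>G. pmf (p s) g * play w s t (f g))"
| "play w s t (Direct ch f) = play w s t (f (ch t))"
| "play w s t (Partial P ch f) = play w s t (f (ch t))"
| "play w s t (Ask C ch f) = play w s t (f (ch t))"

text \<open>A signal of probability zero leads to the belief that vanishes everywhere. The node it leads to
  is never reached, and every choice is optimal there.\<close>

definition posterior ::
    "('s, 'a, 't) persuasion_instance \<Rightarrow> ('s \<Rightarrow> real) \<Rightarrow> ('s \<Rightarrow> nat pmf) \<Rightarrow> nat \<Rightarrow> 's \<Rightarrow> real" where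
  "posterior I b p g s = b s * pmf (p s) g / (\<Sum>s'\<in>States I. b s' * pmf (p s') g)"

definition action_value ::
    "('s, 'a, 't) persuasion_instance \<Rightarrow> ('s \<Rightarrow> real) \<Rightarrow> 't \<Rightarrow> 'a \<Rightarrow> real" where
  "action_value I b t a = (\<Sum>s\<in>States I. b s * agent_payoff I t s a)"

definition continuation_value ::
    "('s, 'a, 't) persuasion_instance \<Rightarrow> ('s \<Rightarrow> real) \<Rightarrow> 't \<Rightarrow> ('s, 'a, 't) mech \<Rightarrow> real" where
  "continuation_value I b t M = (\<Sum>s\<in>States I. b s * play (agent_payoff I t) s t M)"

definition credible_actions ::
    "('s, 'a, 't) persuasion_instance \<Rightarrow> 't set \<Rightarrow> ('s \<Rightarrow> real) \<Rightarrow> 'a set" where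
  "credible_actions I R b =
     {a \<in> Actions I. \<exists>r\<in>R. \<forall>a'\<in>Actions I. action_value I b r a' \<le> action_value I b r a}"

definition maximizes :: "('c \<Rightarrow> real) \<Rightarrow> 'c set \<Rightarrow> 'c \<Rightarrow> bool" where
  "maximizes F X x \<longleftrightarrow> x \<in> X \<and> (\<forall>y\<in>X. F y \<le> F x)"

text \<open>Optimality of all choices by backward induction: at every node, each type's choice maximizes
  his expected payoff under the belief \<open>b\<close>, given his own (optimal) choices further down the tree.
  Choices are not restricted by the true type, only by the binding answers.\<close>

primrec rational ::
    "('s, 'a, 't) persuasion_instance \<Rightarrow> ('s, 'a, 't) mech \<Rightarrow> 't set \<Rightarrow> ('s \<Rightarrow> real) \<Rightarrow> bool" where
  "rational I (Leaf ch) R b \<longleftrightarrow>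
     (\<forall>t\<in>Types I. maximizes (action_value I b t) (credible_actions I R b) (ch t))"
| "rational I (Signal G p f) R b \<longleftrightarrow> (\<forall>g\<in>G. rational I (f g) R (posterior I b p g))"
| "rational I (Direct ch f) R b \<longleftrightarrow>
     (\<forall>r\<in>R. rational I (f r) {r} b) \<and>
     (\<forall>t\<in>Types I. maximizes (\<lambda>r. continuation_value I b t (f r)) R (ch t))"
| "rational I (Partial P ch f) R b \<longleftrightarrow>
     (\<forall>Q\<in>P. rational I (f Q) Q b) \<and>
     (\<forall>t\<in>Types I. maximizes (\<lambda>Q. continuation_value I b t (f Q)) P (ch t))"
| "rational I (Ask C ch f) R b \<longleftrightarrow>
     (\<forall>c\<in>C. rational I (f c) R b) \<and>
     (\<forall>t\<in>Types I. maximizes (\<lambda>c. continuation_value I b t (f c)) C (ch t))"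

definition PIE_mechanism :: "('s, 'a, 't) persuasion_instance \<Rightarrow> ('s, 'a, 't) mech \<Rightarrow> bool" where
  "PIE_mechanism I M \<longleftrightarrow>
     well_formed I M (Types I) \<and> rational I M (Types I) (pmf (prior I))"

definition nonPIE_mechanism :: "('s, 'a, 't) persuasion_instance \<Rightarrow> ('s, 'a, 't) mech \<Rightarrow> bool" where
  "nonPIE_mechanism I M \<longleftrightarrow>
     well_formed I M (Types I) \<and> direct_only I M (Types I) \<and>
     rational I M (Types I) (pmf (prior I))"

definition principal_value :: "('s, 'a, 't) persuasion_instance \<Rightarrow> ('s, 'a, 't) mech \<Rightarrow> real" where
  "principal_value I M =
     (\<Sum>t\<in>Types I. \<Sum>s\<in>States I.
        pmf (type_dist I) t * pmf (prior I) s * play (principal_payoff I) s t M)"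

definition optimal_PIE_mechanism :: "('s, 'a, 't) persuasion_instance \<Rightarrow> ('s, 'a, 't) mech \<Rightarrow> bool" where
  "optimal_PIE_mechanism I M \<longleftrightarrow>
     PIE_mechanism I M \<and> (\<forall>N. PIE_mechanism I N \<longrightarrow> principal_value I N \<le> principal_value I M)"

end

theory Submission
  imports Defs
begin

text \<open>
  Both states are equally likely. The principal wants the action to equal the state \<open>s\<close>. The only
  type of positive probability, type 0, likes this action but likes the action \<open>s + 2\<close> even more;
  the types 1 and 2 always play 0 and 1, respectively. If type 0 has to give up his own identity in
  order to learn the state, he binds himself to \<open>{1, 2}\<close>, and then plays \<open>s\<close>: the principal obtains
  the largest conceivable payoff. Without partial elicitation this is impossible. As long as type 0
  is not excluded, he never plays \<open>s\<close>. When he reports 1 or 2, his action does not depend on the state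
  any more, so it always equals the state only if he knows the state already; but then he prefers to
  report the truth.
\<close>

text \<open>Only nonnegativity, because the belief after a signal of probability zero vanishes
  everywhere.\<close>

definition belief :: "('s, 'a, 't) persuasion_instance \<Rightarrow> ('s \<Rightarrow> real) \<Rightarrow> bool" where
  "belief I b \<longleftrightarrow> (\<forall>s\<in>States I. 0 \<le> b s)"

lemma belief_posterior:
  assumes "belief I b"
  shows "belief I (posterior I b p g)"
  using assms unfolding belief_def posterior_def by (auto intro!: divide_nonneg_nonneg sum_nonneg)

lemma posterior_pos_iff:
  assumes "finite (States I)" "belief I b" "s \<in> States I"
  shows "0 < posterior I b p g s \<longleftrightarrow> 0 < b s \<and> 0 < pmf (p s) g"
proof
  assume "0 < posterior I b p g s"
  then have "b s \<noteq> 0" "pmf (p s) g \<noteq> 0" by (auto simp: posterior_def)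
  with assms show "0 < b s \<and> 0 < pmf (p s) g" by (auto simp: belief_def less_le)
next
  assume pos: "0 < b s \<and> 0 < pmf (p s) g"
  then have "0 < (\<Sum>s'\<in>States I. b s' * pmf (p s') g)"
    using assms by (intro sum_pos2[where i = s]) (auto simp: belief_def)
  with pos show "0 < posterior I b p g s" by (simp add: posterior_def)
qed

lemma play_le_1:
  assumes "\<And>a. w s a \<le> 1"
  shows "play w s t M \<le> 1"
proof (induction M)
  case (Signal G p f)
  show ?case
  \<comment> \<open>The tree is arbitrary here, so \<open>G\<close> may be infinite; the sum is then
    0 by convention.\<close>
  proof (cases "finite G")
    case True
    have "(\<Sum>g\<in>G. pmf (p s) g * play w s t (f g)) \<le> (\<Sum>g\<in>G. pmf (p s) g)"
      using Signal by (intro sum_mono) (simp add: mult_left_le)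
    also have "\<dots> \<le> 1" using True by (simp add: sum_pmf_eq_1 flip: measure_measure_pmf_finite)
    finally show ?thesis by simp
  qed simp
qed (use assms in auto)

lemma play_full_revelation:
  assumes "finite G" "s \<in> G"
  shows "play w s t (Signal G return_pmf f) = play w s t (f s)"
proof -
  have "play w s t (Signal G return_pmf f) = (\<Sum>g\<in>G. if g = s then play w s t (f g) else 0)"
    unfolding play.simps by (intro sum.cong) auto
  with assms show ?thesis by simp
qed

text \<open>Bound to \<open>r\<close>, the agent may only play optimal actions of \<open>r\<close>,
  and \<open>best\<close> leaves \<open>a\<close> alone. \<open>S\<close> records what is known of
  the state: both states when \<open>r\<close> is 1 or 2, the true one when \<open>r\<close> is
  0.\<close>

lemma play_bound_to_type:
  assumes fin: "finite (States I)" and t: "t \<in> Types I" and a: "a \<in> Actions I"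
    and best: "\<And>b s a'. belief I b \<Longrightarrow> \<forall>s\<in>States I - S. b s = 0 \<Longrightarrow> s \<in> States I \<Longrightarrow> 0 < b s
      \<Longrightarrow> a' \<in> Actions I \<Longrightarrow> a' \<noteq> a \<Longrightarrow> action_value I b r a' < action_value I b r a"
    and s: "s \<in> States I"
  shows "well_formed I N {r} \<Longrightarrow> direct_only I N {r} \<Longrightarrow> rational I N {r} b \<Longrightarrow> belief I b
    \<Longrightarrow> \<forall>s\<in>States I - S. b s = 0 \<Longrightarrow> 0 < b s \<Longrightarrow> play w s t N = w s a"
proof (induction N arbitrary: b)
  case (Leaf ch)
  have "ch t \<in> credible_actions I {r} b"
    using Leaf.prems t by (auto simp: maximizes_def)
  then have "ch t \<in> Actions I" "action_value I b r a \<le> action_value I b r (ch t)"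
    using a by (auto simp: credible_actions_def)
  with best[of b s "ch t"] Leaf.prems s have "ch t = a" by force
  then show ?case by simp
next
  case (Signal G p f)
  have "pmf (p s) g * play w s t (f g) = pmf (p s) g * w s a" if "g \<in> G" for g
  proof (cases "pmf (p s) g = 0")
    case False
    then have "0 < pmf (p s) g" by (simp add: less_le)
    \<comment> \<open>Updating never revives an excluded state, so the belief stays within
      \<open>S\<close>.\<close>
    moreover have "posterior I b p g s' = 0" if "b s' = 0" for s'
      using that by (simp add: posterior_def)
    ultimately have "play w s t (f g) = w s a"
      using Signal.prems that posterior_pos_iff[OF fin, of b s p g] s
      by (intro Signal.IH[of _ "posterior I b p g"]) (auto intro: belief_posterior)
    then show ?thesis by simp
  qed simp
  then have "play w s t (Signal G p f) = (\<Sum>g\<in>G. pmf (p s) g) * w s a"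
    unfolding play.simps sum_distrib_right by (intro sum.cong) auto
  also have "(\<Sum>g\<in>G. pmf (p s) g) = 1"
    using Signal.prems s by (intro sum_pmf_eq_1) auto
  finally show ?case by simp
next
  case (Direct ch f)
  have "ch t = r" using Direct.prems t by (auto simp: maximizes_def)
  with Direct show ?case by auto
next
  case (Ask C ch f)
  have "ch t \<in> C" using Ask.prems t by (auto simp: maximizes_def)
  with Ask show ?case by auto
qed auto

text \<open>The weights 2 and 3 satisfy 3/2 < 2 < 3: type 0 prefers \<open>s + 2\<close> to
  \<open>s\<close>, but \<open>s\<close> with the state known to guessing \<open>s + 2\<close> under
  the prior.\<close>

definition menu_instance :: "(nat, nat, nat) persuasion_instance" where
  "menu_instance =
    \<lparr>States = {0, 1}, Actions = {0, 1, 2, 3}, Types = {0, 1, 2},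
     prior = pmf_of_set {0, 1}, type_dist = return_pmf 0,
     principal_payoff = (\<lambda>s a. of_bool (a = s)),
     agent_payoff = (\<lambda>t s a. if t = 0 then 2 * of_bool (a = s) + 3 * of_bool (a = s + 2)
                             else of_bool (t = Suc a))\<rparr>"

lemma menu_instance_simps [simp]:
  "States menu_instance = {0, 1}"
  "Actions menu_instance = {0, 1, 2, 3}"
  "Types menu_instance = {0, 1, 2}"
  "prior menu_instance = pmf_of_set {0, 1}"
  "type_dist menu_instance = return_pmf 0"
  "principal_payoff menu_instance = (\<lambda>s a. of_bool (a = s))"
  "agent_payoff menu_instance =
     (\<lambda>t s a. if t = 0 then 2 * of_bool (a = s) + 3 * of_bool (a = s + 2)
              else of_bool (t = Suc a))"
  by (simp_all add: menu_instance_def)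

lemma principal_value_menu_instance:
  "principal_value menu_instance M =
     (play (principal_payoff menu_instance) 0 0 M + play (principal_payoff menu_instance) 1 0 M) / 2"
  by (simp add: principal_value_def)

lemma play_reported_constant_type:
  assumes r: "r \<in> {1, 2}" and s: "s \<in> {0, 1}"
    and "well_formed menu_instance N {r}" "direct_only menu_instance N {r}"
      "rational menu_instance N {r} b" "belief menu_instance b" "0 < b s"
  shows "play w s 0 N = w s (r - 1)"
  by (rule play_bound_to_type[where S = "{0, 1}" and I = menu_instance and r = r and b = b])
     (use assms in \<open>auto simp: action_value_def belief_def\<close>)

lemma play_reported_truth:
  assumes s: "s \<in> {0, 1}"
    and "well_formed menu_instance N {0}" "direct_only menu_instance N {0}"
      "rational menu_instance N {0} b" "belief menu_instance b" "0 < b s" "b (1 - s) = 0"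
  shows "play w s 0 N = w s (s + 2)"
  by (rule play_bound_to_type[where S = "{s}" and I = menu_instance and r = 0 and b = b])
     (use assms in \<open>auto simp: action_value_def belief_def\<close>)

text \<open>The invariant \<open>0 \<in> R\<close> lasts until type 0 misreports; a misreport is
  compared with the truthful report at that node.\<close>

lemma nonPIE_imperfect:
  assumes "well_formed menu_instance N R" "direct_only menu_instance N R"
    "rational menu_instance N R b" "belief menu_instance b" "s \<in> {0, 1}" "0 < b s"
    "0 \<in> R" "R \<subseteq> {0, 1, 2}"
  shows "\<exists>s\<in>{0, 1}. 0 < b s \<and> play (principal_payoff menu_instance) s 0 N < 1"
  using assms
proof (induction N arbitrary: R b s)
  case (Leaf ch)
  \<comment> \<open>\<open>m\<close> is a likeliest state, so \<open>m + 2\<close> is best for type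
    0: its value \<open>3 * b m\<close> exceeds the value \<open>2 * b s\<close> of action
    \<open>s\<close>.\<close>
  define m :: nat where "m = (if b 0 \<le> b 1 then 1 else 0)"
  have "m + 2 \<in> credible_actions menu_instance R b"
    using Leaf.prems
    by (auto simp: credible_actions_def action_value_def belief_def m_def intro!: bexI[of _ 0])
  then have "action_value menu_instance b 0 (m + 2) \<le> action_value menu_instance b 0 (ch 0)"
    using Leaf.prems by (auto simp: maximizes_def)
  moreover have "0 \<le> b 0" "0 \<le> b 1" using Leaf.prems by (auto simp: belief_def)
  ultimately have "ch 0 \<noteq> s"
    using Leaf.prems by (auto simp: action_value_def m_def split: if_splits)
  with Leaf.prems show ?case by auto
next
  case (Signal G p f)
  obtain g where g: "g \<in> G" "0 < pmf (p s) g"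
    using Signal.prems set_pmf_not_empty[of "p s"] by (fastforce simp: pmf_positive_iff)
  let ?b = "posterior menu_instance b p g"
  have "0 < ?b s"
    using Signal.prems g by (subst posterior_pos_iff) auto
  then obtain s' where s': "s' \<in> {0, 1}" "0 < ?b s'"
      "play (principal_payoff menu_instance) s' 0 (f g) < 1"
    using Signal.IH[of "f g" R ?b s] Signal.prems g belief_posterior[of menu_instance b p g] by auto
  then have pos: "0 < b s'" "0 < pmf (p s') g"
    using posterior_pos_iff[of menu_instance b s' p g] Signal.prems by auto
  \<comment> \<open>Since \<open>g\<close> has positive probability in \<open>s'\<close>, the loss
    after \<open>g\<close> survives averaging.\<close>
  have "play (principal_payoff menu_instance) s' 0 (Signal G p f) < (\<Sum>g\<in>G. pmf (p s') g)"
    unfolding play.simps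
    using Signal.prems g s' pos
    by (intro sum_strict_mono_ex1 bexI[of _ g] ballI mult_left_le play_le_1) auto
  also have "\<dots> = 1" using Signal.prems s' by (intro sum_pmf_eq_1) auto
  finally show ?case using s' pos by blast
next
  case (Direct ch f)
  have wf: "well_formed menu_instance (f r) {r}" "direct_only menu_instance (f r) {r}"
      "rational menu_instance (f r) {r} b" if "r \<in> R" for r
    using Direct.prems that by auto
  have ch: "ch 0 \<in> R"
    and opt: "continuation_value menu_instance b 0 (f 0)
      \<le> continuation_value menu_instance b 0 (f (ch 0))"
    using Direct.prems by (auto simp: maximizes_def)
  show ?case
  proof (cases "ch 0 = 0")
    case True
    with Direct.IH[of "f 0" "{0}" b s] Direct.prems wf[of 0] show ?thesis by auto
  next
    case False
    then have r: "ch 0 \<in> {1, 2}" using ch Direct.prems by auto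
    define s0 where "s0 = ch 0 - 1"
    have s0: "s0 \<in> {0, 1}" using r by (auto simp: s0_def)
    \<comment> \<open>\<open>w\<close> stays open: the principal's payoff measures the loss, type
      0's own payoff enters \<open>opt\<close>.\<close>
    have const: "play w s' 0 (f (ch 0)) = w s' s0" if "s' \<in> {0, 1}" "0 < b s'" for w s'
      unfolding s0_def
      by (rule play_reported_constant_type[where b = b]) (use that wf[OF ch] r Direct.prems in auto)
    show ?thesis
    \<comment> \<open>If the other state \<open>1 - s0\<close> is possible, action \<open>s0\<close>
      misses it. Otherwise type 0 knows that the state is \<open>s0\<close>, and the truth would
      earn him 3 instead of 2.\<close>
    proof (cases "0 < b (1 - s0)")
      case True
      with const[of "1 - s0"] s0 show ?thesis by (intro bexI[of _ "1 - s0"]) auto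
    next
      case False
      then have b0: "b (1 - s0) = 0" using Direct.prems s0 by (auto simp: belief_def)
      then have pos: "0 < b s0" using Direct.prems s0 by auto
      have "play w s0 0 (f 0) = w s0 (s0 + 2)" for w
        by (rule play_reported_truth[where b = b]) (use b0 pos s0 wf[OF \<open>0 \<in> R\<close>] Direct.prems in auto)
      with opt const[OF s0 pos] b0 pos s0 have False
        by (auto simp: continuation_value_def)
      then show ?thesis ..
    qed
  qed
next
  case (Ask C ch f)
  have "ch 0 \<in> C" using Ask.prems by (auto simp: maximizes_def)
  with Ask.IH[of "f (ch 0)" R b s] Ask.prems show ?case by auto
qed auto

text \<open>For type 0, \<open>{0}\<close> is worth 3/2 and \<open>{1, 2}\<close> is worth 2; types
  1 and 2 get 0 and 1. So all choose \<open>{1, 2}\<close>.\<close>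

definition menu_mechanism :: "(nat, nat, nat) mech" where
  "menu_mechanism =
     Partial {{0}, {1, 2}} (\<lambda>t. {1, 2})
       (\<lambda>Q. if Q = {0} then Leaf (\<lambda>t. 2)
            else Signal {0, 1} return_pmf (\<lambda>g. Leaf (\<lambda>t. if t = 0 then g else t - 1)))"

lemma PIE_menu_mechanism: "PIE_mechanism menu_instance menu_mechanism"
proof -
  have [simp]: "{Suc 0, 2} \<noteq> {0}" "{0} \<noteq> {Suc 0, 2}" by auto
  show ?thesis
    by (auto simp: PIE_mechanism_def menu_mechanism_def maximizes_def credible_actions_def
      action_value_def continuation_value_def posterior_def play_full_revelation
      simp del: play.simps(2))
qed

lemma principal_value_menu_mechanism: "principal_value menu_instance menu_mechanism = 1"
proof -
  have [simp]: "{Suc 0, 2} \<noteq> {0}" by auto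
  show ?thesis by (simp add: principal_value_menu_instance menu_mechanism_def
    play_full_revelation del: play.simps(2))
qed

theorem theorem12:
  "\<exists>I :: (nat, nat, nat) persuasion_instance. valid_instance I \<and>
     (\<exists>M. optimal_PIE_mechanism I M \<and>
        (\<forall>N. nonPIE_mechanism I N \<longrightarrow> principal_value I N < principal_value I M))"
proof (intro exI conjI allI impI)
  have le: "play (principal_payoff menu_instance) s 0 N \<le> 1" for s N
    by (rule play_le_1) simp
  show "valid_instance menu_instance" by (simp add: valid_instance_def)
  \<comment> \<open>The bound holds for every tree and is attained, which gives optimality.\<close>
  have "principal_value menu_instance N \<le> 1" for N
    using le[of 0 N] le[of 1 N] by (simp add: principal_value_menu_instance)
  then show "optimal_PIE_mechanism menu_instance menu_mechanism"
    by (simp add: optimal_PIE_mechanism_def PIE_menu_mechanism principal_value_menu_mechanism)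
  fix N assume "nonPIE_mechanism menu_instance N"
  \<comment> \<open>Each state has prior probability 1/2, so a loss in either one lowers the
    value.\<close>
  then obtain s where "s \<in> {0, 1}" "play (principal_payoff menu_instance) s 0 N < 1"
    using nonPIE_imperfect[of N "{0, 1, 2}" "pmf (prior menu_instance)" 0]
    by (auto simp: nonPIE_mechanism_def belief_def)
  with le[of 0 N] le[of 1 N] have "principal_value menu_instance N < 1"
    by (auto simp: principal_value_menu_instance)
  then show "principal_value menu_instance N < principal_value menu_instance menu_mechanism"
    by (simp add: principal_value_menu_mechanism)
qed

end
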